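(* Let $P$ be a nice polygon with vertices $A_0,\dots,A_{n-1}$ (indices taken modulo $n$) and center $O$, and let $f\colon P\to\mathbb{R}$ be convex on every triangle $OA_kA_{k+1}$, $k=0,\dots,n-1$. Then $$\operatorname{Avg}(f,P)\le\frac13f(O)+\frac23\cdot\frac1n\sum_{k=0}^{n-1}\operatorname{Avg}(f,A_kA_{k+1}),$$ $$\operatorname{Avg}(f,P)\le\frac13\cdot\frac1n\sum_{k=0}^{n-1}f(A_k)+\frac23\cdot\frac1n\sum_{k=0}^{n-1}\operatorname{Avg}(f,OA_k),$$ $$\operatorname{Avg}(f,P)\le\frac13f(O)+\frac23\cdot\frac1n\sum_{k=0}^{n-1}f(A_k).$$ If moreover $A_k'=h_O^{2/3}(A_k)$ for $k=0,\dots,n-1$, then $$\frac1n\sum_{k=0}^{n-1}\operatorname{Avg}(f,A_k'A_{k+1}')\le\operatorname{Avg}(f,P).$$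
   Context: A nice polygon is a star-shaped polygon $P$ with vertices $A_0,\dots,A_{n-1}$ for which there exists a point $O$ (called its center) in the kernel of $P$ such that all triangles $OA_kA_{k+1}$, $k=0,\dots,n-1$ (indices mod $n$), have the same area. $h_{\mathbf a}^\lambda(\mathbf x)=\mathbf a+\lambda(\mathbf x-\mathbf a)$ is the homothety with center $\mathbf a$ and ratio $\lambda$. For a set $U$ which is a $k$-dimensional object and an integrable $f$, $\operatorname{Avg}(f,U)=\frac{1}{\operatorname{Vol}_k(U)}\int_U f$, with $\operatorname{Vol}_k$ the $k$-dimensional measure (length, area); $\operatorname{Avg}(f,XY)$ denotes the average over the segment $XY$ with respect to length. *)

theory Defs
  imports "HOL-Analysis.Analysis"
begin

fun polyline :: "(real^2) list \<Rightarrow> real \<Rightarrow> real^2" where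
  "polyline [] = linepath 0 0"
| "polyline [a] = linepath a a"
| "polyline [a, b] = linepath a b"
| "polyline (a # b # c # r) = linepath a b +++ polyline (b # c # r)"

definition polygon_boundary :: "nat \<Rightarrow> (nat \<Rightarrow> real^2) \<Rightarrow> real \<Rightarrow> real^2" where
  "polygon_boundary n A = polyline (map A [0..<n] @ [A 0])"

definition polygon :: "nat \<Rightarrow> (nat \<Rightarrow> real^2) \<Rightarrow> (real^2) set \<Rightarrow> bool" where
  "polygon n A P \<longleftrightarrow> 3 \<le> n \<and> simple_path (polygon_boundary n A) \<and>
     P = path_image (polygon_boundary n A) \<union> inside (path_image (polygon_boundary n A))"

definition kernel :: "(real^2) set \<Rightarrow> (real^2) set" where
  "kernel P = {c \<in> P. \<forall>x\<in>P. closed_segment c x \<subseteq> P}"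

definition nice_polygon :: "nat \<Rightarrow> (nat \<Rightarrow> real^2) \<Rightarrow> real^2 \<Rightarrow> (real^2) set \<Rightarrow> bool" where
  "nice_polygon n A C P \<longleftrightarrow> polygon n A P \<and> C \<in> kernel P \<and>
     (\<forall>k<n. measure lebesgue (convex hull {C, A k, A (Suc k mod n)})
            = measure lebesgue (convex hull {C, A 0, A (Suc 0 mod n)}))"

definition homothety :: "real^2 \<Rightarrow> real \<Rightarrow> real^2 \<Rightarrow> real^2" where
  "homothety a r x = a + r *\<^sub>R (x - a)"

definition avg_area :: "(real^2 \<Rightarrow> real) \<Rightarrow> (real^2) set \<Rightarrow> real" where
  "avg_area f U = integral U f / measure lebesgue U"

text \<open>Average over the segment XY w.r.t. length (via the affine parametrisation).\<close>
definition avg_seg :: "(real^2 \<Rightarrow> real) \<Rightarrow> real^2 \<Rightarrow> real^2 \<Rightarrow> real" where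
  "avg_seg f X Y = integral {0..1} (\<lambda>t. f (linepath X Y t))"

end

theory Submission
  imports Defs
begin

text \<open>
  On a triangle with vertices \<open>c, a, b\<close> put \<open>G x = Avg(f, a\<^sub>x b\<^sub>x)\<close>, where \<open>a\<^sub>x, b\<^sub>x\<close> are the images of
  \<open>a, b\<close> under the homothety with centre \<open>c\<close> and ratio \<open>x\<close>. Slicing the triangle parallel to \<open>ab\<close> gives
  \<open>Avg(f, cab) = 2 \<integral>\<^sub>0\<^sup>1 x G x dx\<close>. As \<open>G\<close> is convex with \<open>G 0 = f c\<close> and \<open>G 1 = Avg(f, ab)\<close>, the chord bound
  yields \<open>Avg(f, cab) \<le> f c / 3 + 2 Avg(f, ab) / 3\<close>, and Jensen's inequality for the probability density
  \<open>2x\<close>, whose mean is \<open>2/3\<close>, yields \<open>G (2/3) \<le> Avg(f, cab)\<close>. The second inequality of the theorem comes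
  from averaging the chord bound over the two other vertices.

  The triangles \<open>C A\<^sub>k A\<^sub>k\<^sub>+\<^sub>1\<close> cover \<open>P\<close>, because a ray from \<open>C\<close> through an inner point leaves \<open>P\<close> through the
  boundary. Two of them overlap in a null set: otherwise some boundary point would lie in the interior
  of a triangle, hence of \<open>P\<close>, although by the Jordan curve theorem it is a limit of outer points.
  Since \<open>P\<close> has nonempty interior, the common area of the triangles is positive.
\<close>

subsection \<open>Convex functions on the unit interval and on triangles\<close>

text \<open>A convex function may jump at the endpoints, but it is bounded on the closed interval
  and continuous on the open one, and two points form a null set.\<close>

lemma convex_on_Icc_integrable:
  fixes g :: "real \<Rightarrow> real"
  assumes "convex_on {0..1} g"
  shows "g absolutely_integrable_on {0..1}"
proof -
  define M where "M = max (g 0) (g 1)"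
  have up: "g t \<le> M" if "t \<in> {0..1}" for t
  proof -
    have "g ((1 - t) *\<^sub>R 0 + t *\<^sub>R 1) \<le> (1 - t) * g 0 + t * g 1"
      using that by (intro convex_onD[OF assms]) auto
    also have "\<dots> \<le> (1 - t) * M + t * M"
      using that by (intro add_mono mult_left_mono) (auto simp: M_def)
    finally show ?thesis by (simp add: algebra_simps)
  qed
  \<comment> \<open>The midpoint 1/2 lies halfway between \<open>t\<close> and its reflection
    \<open>1 - t\<close>, so the upper bound at \<open>1 - t\<close> turns into a lower bound at
    \<open>t\<close>.\<close>
  have lo: "2 * g (1/2) - M \<le> g t" if "t \<in> {0..1}" for t
  proof -
    have "g ((1 - 1/2) *\<^sub>R t + (1/2) *\<^sub>R (1 - t)) \<le> (1 - 1/2) * g t + 1/2 * g (1 - t)"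
      using that by (intro convex_onD[OF assms]) auto
    also have "(1 - 1/2) *\<^sub>R t + (1/2) *\<^sub>R (1 - t) = 1/2" by (simp add: field_simps)
    finally show ?thesis using up[of "1-t"] that by simp
  qed
  have "convex_on {0<..<1} g"
    using assms by (rule convex_on_subset) auto
  then have "continuous_on {0<..<1} g"
    by (rule convex_on_continuous[rotated]) auto
  then have "g absolutely_integrable_on {0<..<1}"
  proof (intro measurable_bounded_by_integrable_imp_absolutely_integrable)
    show "(\<lambda>x. \<bar>M\<bar> + \<bar>2 * g (1/2) - M\<bar>) integrable_on {0<..<1::real}"
      using integrable_on_open_interval_real integrable_const_ivl by blast
    show "norm (g x) \<le> \<bar>M\<bar> + \<bar>2 * g (1/2) - M\<bar>" if "x \<in> {0<..<1}" for x
      using up[of x] lo[of x] that by auto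
  qed (auto intro: continuous_imp_measurable_on_sets_lebesgue)
  then show ?thesis
    by (rule absolutely_integrable_spike_set)
       (auto intro: negligible_subset[of "{0,1}"])
qed

lemma integral_id_mult_convex_bounds:
  fixes g :: "real \<Rightarrow> real"
  assumes "convex_on {0..1} g"
  shows "(\<lambda>x. x * g x) integrable_on {0..1}"
    and "2 * integral {0..1} (\<lambda>x. x * g x) \<le> 1/3 * g 0 + 2/3 * g 1"
    and "g (2/3) \<le> 2 * integral {0..1} (\<lambda>x. x * g x)"
proof -
  have quad: "((\<lambda>x. x * (\<alpha> + \<beta> * x)) has_integral \<alpha> / 2 + \<beta> / 3) {0..1}" for \<alpha> \<beta> :: real
  proof -
    have "((\<lambda>x. x * (\<alpha> + \<beta> * x)) has_integral 
        ((\<lambda>x. \<alpha> * x^2 / 2 + \<beta> * x^3 / 3) 1 - (\<lambda>x. \<alpha> * x^2 / 2 + \<beta> * x^3 / 3) 0)) {0..1}"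
      by (rule fundamental_theorem_of_calculus)
         (auto intro!: derivative_eq_intros simp flip: has_real_derivative_iff_has_vector_derivative
           simp: power2_eq_square algebra_simps)
    then show ?thesis by simp
  qed
  have "(\<lambda>x. x * g x) absolutely_integrable_on {0..1}"
    by (rule absolutely_integrable_bounded_measurable_product_real)
       (auto intro: convex_on_Icc_integrable[OF assms] continuous_imp_measurable_on_sets_lebesgue
         compact_imp_bounded)
  then show int: "(\<lambda>x. x * g x) integrable_on {0..1}"
    by (rule set_lebesgue_integral_eq_integral(1))
  have "integral {0..1} (\<lambda>x. x * g x) \<le> g 0 / 2 + (g 1 - g 0) / 3"
  proof (rule has_integral_le[OF integrable_integral[OF int] quad])
    fix x :: real assume x: "x \<in> {0..1}"
    have "g ((1 - x) *\<^sub>R 0 + x *\<^sub>R 1) \<le> (1 - x) * g 0 + x * g 1"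
      using x by (intro convex_onD[OF assms]) auto
    then show "x * g x \<le> x * (g 0 + (g 1 - g 0) * x)"
      using x by (intro mult_left_mono) (auto simp: algebra_simps)
  qed
  then show "2 * integral {0..1} (\<lambda>x. x * g x) \<le> 1/3 * g 0 + 2/3 * g 1"
    by (simp add: field_simps)
  \<comment> \<open>A supporting line at 2/3. Its slope \<open>m\<close> drops out of the integral
    because 2/3 is the mean of the density \<open>2x\<close>: the value below is just half of
    \<open>g (2/3)\<close>.\<close>
  obtain m where m: "\<And>y. y \<in> {0..1} \<Longrightarrow> g y \<ge> g (2/3) + m * (y - 2/3)"
    using convex_le_Inf_differential[OF assms, of "2/3"] by auto
  have "(g (2/3) - m * 2/3) / 2 + m / 3 \<le> integral {0..1} (\<lambda>x. x * g x)"
  proof (rule has_integral_le[OF quad integrable_integral[OF int]])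
    fix x :: real assume x: "x \<in> {0..1}"
    then show "x * (g (2/3) - m * 2/3 + m * x) \<le> x * g x"
      using m[of x] by (intro mult_left_mono) (auto simp: algebra_simps)
  qed
  then show "g (2/3) \<le> 2 * integral {0..1} (\<lambda>x. x * g x)"
    by (simp add: field_simps)
qed

lemma convex_on_triangle_bounded:
  fixes f :: "'a::real_vector \<Rightarrow> real"
  assumes "convex_on (convex hull {p,q,r}) f"
  shows "\<exists>B. \<forall>x\<in>convex hull {p,q,r}. \<bar>f x\<bar> \<le> B"
proof -
  define M where "M = max (f p) (max (f q) (f r))"
  have up: "\<forall>x\<in>convex hull {p,q,r}. f x \<le> M"
    by (rule convex_on_convex_hull_bound[OF assms]) (auto simp: M_def)
  define c where "c = (1/3) *\<^sub>R p + (1/3) *\<^sub>R q + (1/3) *\<^sub>R r"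
  have lo: "3 * f c - 2 * M \<le> f x" if x: "x \<in> convex hull {p,q,r}" for x
  proof -
    obtain u v w where uvw: "0 \<le> u" "0 \<le> v" "0 \<le> w" "u + v + w = 1" 
      and xe: "x = u *\<^sub>R p + v *\<^sub>R q + w *\<^sub>R r"
      using x unfolding convex_hull_3 by blast
    \<comment> \<open>The point \<open>y\<close> is chosen so that the centroid \<open>c\<close>
      equals \<open>x/3 + 2y/3\<close>; convexity at \<open>c\<close> and the upper bound at
      \<open>y\<close> then bound \<open>f x\<close> from below.\<close>
    define y where "y = ((1-u)/2) *\<^sub>R p + ((1-v)/2) *\<^sub>R q + ((1-w)/2) *\<^sub>R r"
    have "(1 - u) / 2 + (1 - v) / 2 + (1 - w) / 2 = 1"
      using uvw(4) by (simp add: field_simps)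
    then have y: "y \<in> convex hull {p,q,r}"
      unfolding convex_hull_3 y_def using uvw
      by (intro CollectI, rule_tac exI[of _ "(1-u)/2"], rule_tac exI[of _ "(1-v)/2"],
          rule_tac exI[of _ "(1-w)/2"]) auto
    have "f ((1 - 2/3) *\<^sub>R x + (2/3) *\<^sub>R y) \<le> (1 - 2/3) * f x + 2/3 * f y"
      using x y by (intro convex_onD[OF assms]) auto
    moreover have "(1 - 2/3) *\<^sub>R x + (2/3) *\<^sub>R y = c"
    proof -
      have *: "2/3 * ((1 - z) / 2) = (1 - z) / 3" "(1 - 2/3) * z = z / 3" for z :: real
        by (simp_all add: field_simps)
      have "(1 - 2/3) *\<^sub>R x + (2/3) *\<^sub>R y = (u/3 + (1-u)/3) *\<^sub>R p + (v/3 + (1-v)/3) *\<^sub>R q + (w/3 + (1-w)/3) *\<^sub>R r"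
        unfolding xe y_def scaleR_add_left scaleR_add_right scaleR_scaleR *
        by (simp only: add_ac)
      then show ?thesis by (simp add: c_def add_divide_distrib[symmetric])
    qed
    ultimately show ?thesis using up y by force
  qed
  show ?thesis
    using up lo by (intro exI[of _ "\<bar>M\<bar> + \<bar>3 * f c - 2 * M\<bar>"]) force
qed

subsection \<open>Integration over a triangle\<close>

lemma borel_measurable_vec2_of_pair:
  "(\<lambda>z. vector [fst z, snd z] :: real^2) \<in> borel_measurable (lborel :: (real \<times> real) measure)"
proof -
  have "(\<lambda>z. vector [fst z, snd z] :: real^2) = (\<lambda>z. fst z *\<^sub>R axis 1 1 + snd z *\<^sub>R axis 2 1)"
    by (auto simp: fun_eq_iff vec_eq_iff forall_2 axis_def)
  moreover have "continuous_on UNIV (\<lambda>z::real\<times>real. fst z *\<^sub>R axis 1 1 + snd z *\<^sub>R axis 2 1 :: real^2)"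
    by (intro continuous_intros)
  ultimately show ?thesis
    using borel_measurable_continuous_onI by (simp only: measurable_lborel1 measurable_lborel2)
qed

text \<open>Lebesgue measure is determined by its values on boxes, and the preimage of a box in
  \<open>real^2\<close> is the box in the product with the same side lengths. This carries Fubini's
  theorem over from pairs.\<close>

lemma lborel_vec2_eq_distr:
  "lborel = distr (lborel :: (real \<times> real) measure) borel (\<lambda>z. vector [fst z, snd z] :: real^2)"
    (is "_ = distr _ _ ?e")
proof (rule lborel_eqI)
  note meas = borel_measurable_vec2_of_pair
  fix l u :: "real^2" assume le: "\<And>b. b \<in> Basis \<Longrightarrow> l \<bullet> b \<le> u \<bullet> b"
  have le': "l $ i \<le> u $ i" for i
    using le[of "axis i 1"] by (simp add: inner_axis)
  have vim: "?e -` box l u = box (l $ 1, l $ 2) (u $ 1, u $ 2)"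
    by (auto simp: mem_box_cart forall_2 mem_box Basis_prod_def ball_Un)
  have "emeasure (distr lborel borel ?e) (box l u) = (u $ 1 - l $ 1) * (u $ 2 - l $ 2)"
    using meas le' by (simp add: emeasure_distr vim emeasure_lborel_box_eq Basis_prod_def
        prod.union_disjoint prod.reindex inj_on_def)
  also have "\<dots> = (\<Prod>b\<in>Basis. (u - l) \<bullet> b)"
    by (simp add: Basis_vec_def UNIV_2 inner_axis axis_eq_axis mult.commute)
  finally show "emeasure (distr lborel borel ?e) (box l u) = (\<Prod>b\<in>Basis. (u - l) \<bullet> b)" .
qed simp

lemma integral_lborel_vec2:
  fixes F :: "real^2 \<Rightarrow> real"
  assumes "integrable lborel F"
  shows "integral\<^sup>L lborel F = (\<integral>x. (\<integral>y. F (vector [x, y]) \<partial>lborel) \<partial>lborel)"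
proof -
  let ?e = "\<lambda>z. vector [fst z, snd z] :: real^2"
  note meas = borel_measurable_vec2_of_pair
  have F: "F \<in> borel_measurable borel"
    using assms by auto
  have "integrable (distr lborel borel ?e) F"
    using assms unfolding lborel_vec2_eq_distr .
  then have int: "integrable (lborel \<Otimes>\<^sub>M lborel) (\<lambda>z. F (?e z))"
    using meas by (simp add: integrable_distr_eq F lborel_prod)
  have "integral\<^sup>L lborel F = integral\<^sup>L (distr lborel borel ?e) F"
    by (simp flip: lborel_vec2_eq_distr)
  also have "\<dots> = integral\<^sup>L (lborel \<Otimes>\<^sub>M lborel) (\<lambda>z. F (?e z))"
    using meas by (simp add: integral_distr F lborel_prod)
  also have "\<dots> = (\<integral>x. (\<integral>y. F (vector [x, y]) \<partial>lborel) \<partial>lborel)"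
    using lborel_pair.integral_fst'[OF int] by simp
  finally show ?thesis .
qed

text \<open>Links the iterated integrals coming from Fubini with the integral used in
  \<open>avg_seg\<close>. Continuity on the open interval supplies Borel measurability; the
  endpoints are null.\<close>

lemma lborel_integral_Ioo_eq_integral_Icc:
  fixes h :: "real \<Rightarrow> real"
  assumes "continuous_on {0<..<1} h" "h absolutely_integrable_on {0..1}"
  shows "(\<integral>x. indicator {0<..<1} x * h x \<partial>lborel) = integral {0..1} h"
proof -
  have ai: "h absolutely_integrable_on {0<..<1}"
    using assms(2) by (rule absolutely_integrable_spike_set)
       (auto intro: negligible_subset[of "{0,1}"])
  have "(\<lambda>x. indicator {0<..<1} x *\<^sub>R h x) \<in> borel_measurable borel"
    by (rule borel_measurable_continuous_on_indicator) (use assms in auto)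
  then have "(\<integral>x. indicator {0<..<1} x * h x \<partial>lborel) = (LINT x:{0<..<1}|lebesgue. h x)"
    unfolding set_lebesgue_integral_def by (simp add: integral_completion)
  also have "\<dots> = integral {0<..<1} h"
    using ai by (rule set_lebesgue_integral_eq_integral(2))
  finally show ?thesis by (simp add: integral_open_interval_real)
qed

section \<open>Slices of a triangle parallel to a side\<close>

lemma homothety_segment:
  "linepath (homothety c x a) (homothety c x b) t
    = c + x *\<^sub>R ((1 - t) *\<^sub>R (a - c) + t *\<^sub>R (b - c))"
  by (simp add: linepath_def homothety_def algebra_simps)

lemma homothety_segment_in_triangle:
  assumes "x \<in> {0..1}" "t \<in> {0..1}"
  shows "linepath (homothety c x a) (homothety c x b) t \<in> convex hull {c, a, b}"
  unfolding homothety_segment convex_hull_3_alt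
proof (intro CollectI exI conjI)
  show "c + x *\<^sub>R ((1 - t) *\<^sub>R (a - c) + t *\<^sub>R (b - c)) = 
        c + (x * (1 - t)) *\<^sub>R (a - c) + (x * t) *\<^sub>R (b - c)"
    by (simp add: algebra_simps)
  show "x * (1 - t) + x * t \<le> 1" using assms by (simp add: algebra_simps)
qed (use assms in auto)

lemma convex_on_homothety_segment:
  fixes f :: "real^2 \<Rightarrow> real"
  assumes f: "convex_on (convex hull {c, a, b}) f" and x: "x \<in> {0..1}"
  shows "convex_on {0..1} (\<lambda>t. f (linepath (homothety c x a) (homothety c x b) t))"
proof (rule convex_onI)
  fix u s t :: real
  assume *: "0 < u" "u < 1" "s \<in> {0..1}" "t \<in> {0..1}"
  let ?l = "linepath (homothety c x a) (homothety c x b)"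
  have "f (?l ((1 - u) *\<^sub>R s + u *\<^sub>R t)) = f ((1 - u) *\<^sub>R ?l s + u *\<^sub>R ?l t)"
    by (simp add: homothety_segment algebra_simps)
  also have "\<dots> \<le> (1 - u) * f (?l s) + u * f (?l t)"
    using * x by (intro convex_onD[OF f] homothety_segment_in_triangle) auto
  finally show "f (?l ((1 - u) *\<^sub>R s + u *\<^sub>R t)) \<le> (1 - u) * f (?l s) + u * f (?l t)" .
qed auto

text \<open>For a fixed position \<open>t\<close> on the slice, the point
  \<open>c + x((1 - t)(a - c) + t(b - c))\<close> is affine in the ratio \<open>x\<close>. Hence
  \<open>f\<close> is convex in \<open>x\<close> there, and integrating over \<open>t\<close>
  preserves the inequality.\<close>

lemma convex_on_avg_seg_homothety:
  fixes f :: "real^2 \<Rightarrow> real"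
  assumes f: "convex_on (convex hull {c, a, b}) f"
  shows "convex_on {0..1} (\<lambda>x. avg_seg f (homothety c x a) (homothety c x b))"
proof (rule convex_onI)
  fix u x y :: real
  assume *: "0 < u" "u < 1" "x \<in> {0..1}" "y \<in> {0..1}"
  let ?l = "\<lambda>x. linepath (homothety c x a) (homothety c x b)"
  let ?z = "(1 - u) *\<^sub>R x + u *\<^sub>R y"
  have int: "(\<lambda>t. f (?l x t)) integrable_on {0..1}" if "x \<in> {0..1}" for x
    using convex_on_Icc_integrable[OF convex_on_homothety_segment[OF f that]]
    by (rule set_lebesgue_integral_eq_integral(1))
  have z: "?z \<in> {0..1}"
    using * convexD_alt[of "{0..1::real}" x y u] by auto
  have "avg_seg f (homothety c ?z a) (homothety c ?z b)
      \<le> integral {0..1} (\<lambda>t. (1 - u) * f (?l x t) + u * f (?l y t))"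
    unfolding avg_seg_def
  proof (rule integral_le)
    show "(\<lambda>t. (1 - u) * f (?l x t) + u * f (?l y t)) integrable_on {0..1}"
      using * by (intro integrable_add integrable_on_mult_right int)
    fix t :: real assume t: "t \<in> {0..1}"
    have "f (?l ?z t) = f ((1 - u) *\<^sub>R ?l x t + u *\<^sub>R ?l y t)"
      by (simp add: homothety_segment algebra_simps)
    also have "\<dots> \<le> (1 - u) * f (?l x t) + u * f (?l y t)"
      using * t by (intro convex_onD[OF f] homothety_segment_in_triangle) auto
    finally show "f (?l ?z t) \<le> (1 - u) * f (?l x t) + u * f (?l y t)" .
  qed (rule int[OF z])
  also have "\<dots> = (1 - u) * avg_seg f (homothety c x a) (homothety c x b)
      + u * avg_seg f (homothety c y a) (homothety c y b)"
    unfolding avg_seg_def using int * by (subst integral_add) (auto intro: integrable_on_mult_right)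
  finally show "avg_seg f (homothety c ?z a) (homothety c ?z b)
      \<le> (1 - u) * avg_seg f (homothety c x a) (homothety c x b)
      + u * avg_seg f (homothety c y a) (homothety c y b)" .
qed auto

text \<open>The change of variables theorem for vector-valued integrands is applied with
  \<open>f\<close> read as a function into \<open>real^1\<close>.\<close>

lemma integral_change_of_variables_real_valued:
  fixes f :: "real^'m::{finite,wellorder} \<Rightarrow> real" and g :: "real^'m::_ \<Rightarrow> real^'m::_"
  assumes S: "S \<in> sets lebesgue"
    and der_g: "\<And>x. x \<in> S \<Longrightarrow> (g has_derivative g' x) (at x within S)"
    and inj: "inj_on g S"
    and f: "f absolutely_integrable_on (g ` S)"
  shows "(\<lambda>x. \<bar>det (matrix (g' x))\<bar> * f (g x)) absolutely_integrable_on S"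
    and "integral S (\<lambda>x. \<bar>det (matrix (g' x))\<bar> * f (g x)) = integral (g ` S) f"
proof -
  have f1: "(\<lambda>x. vec (f x) :: real^1) absolutely_integrable_on (g ` S)"
    using f by (simp add: absolutely_integrable_on_1_iff)
  show "(\<lambda>x. \<bar>det (matrix (g' x))\<bar> * f (g x)) absolutely_integrable_on S"
    using absolutely_integrable_change_of_variables[OF S der_g inj, of "\<lambda>x. vec (f x) :: real^1"] f1
    by (simp add: absolutely_integrable_on_1_iff)
  show "integral S (\<lambda>x. \<bar>det (matrix (g' x))\<bar> * f (g x)) = integral (g ` S) f"
    using integral_change_of_variables[OF S der_g inj, of "\<lambda>x. vec (f x) :: real^1"] f1
    by (simp add: integral_on_1_eq)
qed

lemma negligible_closed_segment:
  fixes a b :: "real^2"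
  shows "negligible (closed_segment a b)"
  by (simp add: negligible_convex_interior interior_closed_segment_ge2)

lemma negligible_degenerate_triangle:
  fixes a b c :: "real^2"
  assumes "(a - c) $ 1 * (b - c) $ 2 = (b - c) $ 1 * (a - c) $ 2"
  shows "negligible (convex hull {c, a, b})"
proof (cases "a = c")
  case True
  then show ?thesis
    using negligible_closed_segment[of c b] by (simp add: segment_convex_hull)
next
  case False
  \<comment> \<open>The vector \<open>a - c\<close> turned by a right angle. The vanishing
    determinant puts all three vertices on one line with normal \<open>w\<close>.\<close>
  define w :: "real^2" where "w = vector [- (a - c) $ 2, (a - c) $ 1]"
  have "w \<noteq> 0"
    using False by (auto simp: w_def vec_eq_iff forall_2)
  have "convex hull {c, a, b} \<subseteq> {x. w \<bullet> x = w \<bullet> c}"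
  proof (rule hull_minimal)
    show "{c, a, b} \<subseteq> {x. w \<bullet> x = w \<bullet> c}"
      using assms by (auto simp: w_def inner_vec_def sum_2 algebra_simps)
  qed (rule convex_hyperplane)
  then show ?thesis
    using negligible_hyperplane[of w "w \<bullet> c"] \<open>w \<noteq> 0\<close> by (auto intro: negligible_subset)
qed

text \<open>Inside the triangle \<open>f\<close> is continuous and bounded; the frontier of a convex
  set is null, so arbitrary behaviour of \<open>f\<close> there is harmless.\<close>

lemma convex_on_triangle_absolutely_integrable:
  fixes f :: "real^2 \<Rightarrow> real"
  assumes f: "convex_on (convex hull {c, a, b}) f"
  shows "f absolutely_integrable_on (convex hull {c, a, b})"
proof -
  let ?T = "convex hull {c, a, b}"
  obtain B where B: "\<forall>x\<in>?T. \<bar>f x\<bar> \<le> B"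
    using convex_on_triangle_bounded[OF f] by blast
  have T: "compact ?T"
    by (simp add: compact_convex_hull finite_imp_compact)
  have "continuous_on (interior ?T) f"
    by (rule convex_on_continuous)
       (auto intro: convex_on_subset[OF f interior_subset] convex_interior convex_convex_hull)
  then have "f absolutely_integrable_on interior ?T"
  proof (intro measurable_bounded_by_integrable_imp_absolutely_integrable)
    have "interior ?T \<in> lmeasurable"
      by (intro lmeasurable_interior compact_imp_bounded T)
    then show "(\<lambda>x. B) integrable_on interior ?T"
      by (rule integrable_on_const)
    show "norm (f x) \<le> B" if "x \<in> interior ?T" for x
      using B interior_subset that by fastforce
  qed (auto intro: continuous_imp_measurable_on_sets_lebesgue)
  then show ?thesis
  proof (rule absolutely_integrable_spike_set)
    have "?T - interior ?T \<subseteq> frontier ?T"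
      using T by (simp add: compact_imp_closed frontier_def)
    then show "negligible {x \<in> ?T - interior ?T. f x \<noteq> 0}"
      by (auto intro: negligible_subset[OF negligible_convex_frontier[of ?T]])
    have "{x \<in> interior ?T - ?T. f x \<noteq> 0} = {}" using interior_subset by blast
    then show "negligible {x \<in> interior ?T - ?T. f x \<noteq> 0}" by (simp only: negligible_empty)
  qed
qed

text \<open>The unit square is mapped onto the triangle by (ratio of the slice, position on the
  slice). The Jacobian is the ratio times a constant determinant, which yields the weight
  \<open>x\<close>; Fubini then integrates along each slice first. If the determinant vanishes, both
  sides are 0.\<close>

lemma integral_triangle_eq_radial:
  fixes f :: "real^2 \<Rightarrow> real"
  assumes f: "convex_on (convex hull {c, a, b}) f"
  shows "integral (convex hull {c, a, b}) f
    = \<bar>(a - c) $ 1 * (b - c) $ 2 - (b - c) $ 1 * (a - c) $ 2\<bar> *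
       integral {0..1} (\<lambda>x. x * avg_seg f (homothety c x a) (homothety c x b))"
    (is "integral ?T f = \<bar>?K\<bar> * integral {0..1} ?h")
proof (cases "?K = 0")
  case True
  then show ?thesis
    using negligible_degenerate_triangle[of a c b] by (simp add: integral_negligible)
next
  case K: False
  define p q where "p = a - c" and "q = b - c"
  \<comment> \<open>The open square, since \<open>f\<close> need not be Borel measurable on the boundary of the triangle.\<close>
  define S :: "(real^2) set" where "S = box 0 1"
  define \<phi> :: "real^2 \<Rightarrow> real^2" where
    "\<phi> v = linepath (homothety c (v $ 1) a) (homothety c (v $ 1) b) (v $ 2)" for v
  define \<phi>' :: "real^2 \<Rightarrow> real^2 \<Rightarrow> real^2" where
    "\<phi>' v h = h $ 1 *\<^sub>R ((1 - v $ 2) *\<^sub>R p + v $ 2 *\<^sub>R q) + (v $ 1 * h $ 2) *\<^sub>R (q - p)" for v h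
  have \<phi>: "\<phi> v = c + (v $ 1) *\<^sub>R ((1 - v $ 2) *\<^sub>R p + v $ 2 *\<^sub>R q)" for v
    by (simp add: \<phi>_def homothety_segment p_def q_def)
  have K': "p $ 1 * q $ 2 - q $ 1 * p $ 2 \<noteq> 0"
    using K by (simp add: p_def q_def)
  have mem_S: "v \<in> S \<longleftrightarrow> 0 < v $ 1 \<and> v $ 1 < 1 \<and> 0 < v $ 2 \<and> v $ 2 < 1" for v
    by (auto simp: S_def mem_box_cart forall_2)
  have S: "open S" "S \<in> sets borel" "S \<in> sets lebesgue"
    by (auto simp: S_def)
  have der: "(\<phi> has_derivative \<phi>' v) (at v within S)" for v
    unfolding \<phi>[abs_def] \<phi>'_def[abs_def]
    by (auto intro!: derivative_eq_intros bounded_linear.has_derivative[OF bounded_linear_vec_nth]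
         simp: fun_eq_iff algebra_simps)
  have det: "det (matrix (\<phi>' v)) = v $ 1 * (p $ 1 * q $ 2 - q $ 1 * p $ 2)" for v
    by (simp add: det_2 matrix_def \<phi>'_def axis_def algebra_simps)
  have inj: "inj_on \<phi> S"
  proof (rule inj_onI)
    fix v w assume vw: "v \<in> S" "w \<in> S" "\<phi> v = \<phi> w"
    \<comment> \<open>\<open>\<alpha>\<close> and \<open>\<beta>\<close> are the coordinates of
      \<open>\<phi> v - \<phi> w\<close> with respect to the independent vectors \<open>p\<close>
      and \<open>q\<close>, so Cramer's rule makes both vanish. Their sum is the difference of the
      two ratios.\<close>
    define \<alpha> where "\<alpha> = v $ 1 * (1 - v $ 2) - w $ 1 * (1 - w $ 2)"
    define \<beta> where "\<beta> = v $ 1 * v $ 2 - w $ 1 * w $ 2"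
    have eq: "\<alpha> * p $ i + \<beta> * q $ i = 0" for i
      using arg_cong[OF vw(3), of "\<lambda>z. z $ i"] by (simp add: \<phi> \<alpha>_def \<beta>_def algebra_simps)
    have "\<alpha> * (p $ 1 * q $ 2 - q $ 1 * p $ 2) = (\<alpha> * p $ 1 + \<beta> * q $ 1) * q $ 2 - (\<alpha> * p $ 2 + \<beta> * q $ 2) * q $ 1"
      by (simp add: algebra_simps)
    then have "\<alpha> = 0" using K' eq by simp
    have "\<beta> * (p $ 1 * q $ 2 - q $ 1 * p $ 2) = (\<alpha> * p $ 2 + \<beta> * q $ 2) * p $ 1 - (\<alpha> * p $ 1 + \<beta> * q $ 1) * p $ 2"
      by (simp add: algebra_simps)
    then have "\<beta> = 0" using K' eq by simp
    have "v $ 1 = w $ 1" using \<open>\<alpha> = 0\<close> \<open>\<beta> = 0\<close> by (simp add: \<alpha>_def \<beta>_def algebra_simps)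
    moreover have "v $ 2 = w $ 2" using calculation \<open>\<beta> = 0\<close> vw(2) by (simp add: \<beta>_def mem_S)
    ultimately show "v = w" by (simp add: vec_eq_iff forall_2)
  qed
  have cont: "continuous_on S \<phi>"
    using der by (meson has_derivative_continuous_on)
  have sub: "\<phi> ` S \<subseteq> ?T"
    unfolding \<phi>_def by (auto simp: mem_S intro!: homothety_segment_in_triangle)
  \<comment> \<open>An open subset of the triangle lies in its interior, where \<open>f\<close> is
    continuous. This makes the transformed integrand Borel on the square, as needed for
    Fubini.\<close>
  have "open (\<phi> ` S)"
    using invariance_of_domain[OF cont] S inj by blast
  with sub have sub': "\<phi> ` S \<subseteq> interior ?T"
    by (simp add: interior_maximal)
  have contf: "continuous_on (interior ?T) f"
    by (rule convex_on_continuous)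
       (auto intro: convex_on_subset[OF f interior_subset] convex_interior convex_convex_hull)
  have bd: "?T - \<phi> ` S \<subseteq> closed_segment c a \<union> closed_segment c b \<union> closed_segment a b"
  proof
    fix z assume z: "z \<in> ?T - \<phi> ` S"
    then obtain u v where uv: "0 \<le> u" "0 \<le> v" "u + v \<le> 1" 
      and ze: "z = c + u *\<^sub>R p + v *\<^sub>R q"
      unfolding convex_hull_3_alt p_def q_def by blast
    consider "v = 0" | "u = 0" | "u + v = 1" | "u > 0" "v > 0" "u + v < 1"
      using uv by linarith
    then show "z \<in> closed_segment c a \<union> closed_segment c b \<union> closed_segment a b"
    proof cases
      case 1
      then have "z \<in> closed_segment c a"
        using uv ze by (auto simp: in_segment p_def algebra_simps intro!: exI[of _ u])
      then show ?thesis by blast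
    next
      case 2
      then have "z \<in> closed_segment c b"
        using uv ze by (auto simp: in_segment q_def algebra_simps intro!: exI[of _ v])
      then show ?thesis by blast
    next
      case 3
      then have u: "u = 1 - v" by simp
      have "z \<in> closed_segment a b"
        using uv ze unfolding u by (auto simp: in_segment p_def q_def algebra_simps intro!: exI[of _ v])
      then show ?thesis by blast
    next
      case 4
      \<comment> \<open>The preimage of \<open>z\<close>: the slice through \<open>z\<close> has
        ratio \<open>u + v\<close>, and \<open>v / (u + v)\<close> is the position of
        \<open>z\<close> on it.\<close>
      define w :: "real^2" where "w = vector [u + v, v / (u + v)]"
      have "w \<in> S" using 4 by (simp add: mem_S w_def)
      moreover have "\<phi> w = z"
      proof -
        have "\<phi> w = c + ((u + v) * (1 - v / (u + v))) *\<^sub>R p + ((u + v) * (v / (u + v))) *\<^sub>R q"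
          by (simp add: \<phi> w_def algebra_simps)
        also have "(u + v) * (1 - v / (u + v)) = u" using 4 by (simp add: field_simps)
        also have "(u + v) * (v / (u + v)) = v" using 4 by simp
        finally show ?thesis by (simp add: ze)
      qed
      ultimately show ?thesis using z by blast
    qed
  qed
  have neg: "negligible (?T - \<phi> ` S)"
    using bd by (rule negligible_subset[rotated]) (simp add: negligible_closed_segment)
  have ai: "f absolutely_integrable_on \<phi> ` S"
    using convex_on_triangle_absolutely_integrable[OF f] 
    by (rule absolutely_integrable_spike_set)
       (use neg sub in \<open>auto intro: negligible_subset simp: Diff_eq_empty_iff[THEN iffD2]\<close>)
  let ?H = "\<lambda>v. \<bar>v $ 1 * ?K\<bar> * f (\<phi> v)"
  have aiH: "?H absolutely_integrable_on S"
    and intH: "integral S ?H = integral (\<phi> ` S) f"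
    using integral_change_of_variables_real_valued[OF S(3) der inj ai] 
    by (simp_all add: det p_def q_def)
  have "continuous_on S (\<lambda>v. f (\<phi> v))"
    by (rule continuous_on_compose2[OF contf cont sub'])
  then have "continuous_on S ?H"
    by (intro continuous_intros)
  then have Hb: "(\<lambda>v. indicator S v *\<^sub>R ?H v) \<in> borel_measurable borel"
    by (rule borel_measurable_continuous_on_indicator[OF S(2)])
  have inner: "(\<integral>y. indicator S (vector [x, y] :: real^2) *\<^sub>R ?H (vector [x, y]) \<partial>lborel)
     = indicator {0<..<1} x * (\<bar>?K\<bar> * ?h x)" for x
  proof (cases "x \<in> {0<..<1}")
    case x: True
    let ?g = "\<lambda>y. f (linepath (homothety c x a) (homothety c x b) y)"
    have cv: "convex_on {0..1} ?g"
      using x by (intro convex_on_homothety_segment[OF f]) auto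
    have "(\<integral>y. indicator S (vector [x, y] :: real^2) *\<^sub>R ?H (vector [x, y]) \<partial>lborel)
       = (\<integral>y. (x * \<bar>?K\<bar>) * (indicator {0<..<1} y * ?g y) \<partial>lborel)"
      using x by (intro Bochner_Integration.integral_cong)
         (auto simp: indicator_def mem_S \<phi>_def abs_mult)
    also have "\<dots> = (x * \<bar>?K\<bar>) * (\<integral>y. indicator {0<..<1} y * ?g y \<partial>lborel)"
      by simp
    also have "(\<integral>y. indicator {0<..<1} y * ?g y \<partial>lborel) = integral {0..1} ?g"
    proof (rule lborel_integral_Ioo_eq_integral_Icc)
      show "continuous_on {0<..<1} ?g"
        by (rule convex_on_continuous) (auto intro: convex_on_subset[OF cv])
    qed (rule convex_on_Icc_integrable[OF cv])
    finally show ?thesis using x by (simp add: avg_seg_def)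
  next
    case False
    then have "(\<lambda>y. indicator S (vector [x, y] :: real^2) *\<^sub>R ?H (vector [x, y])) = (\<lambda>y. 0)"
      by (auto simp: fun_eq_iff indicator_def mem_S)
    then show ?thesis using False by simp
  qed
  have cG: "convex_on {0..1} (\<lambda>x. avg_seg f (homothety c x a) (homothety c x b))"
    by (rule convex_on_avg_seg_homothety[OF f])
  have "integral ?T f = integral (\<phi> ` S) f"
    by (rule integral_spike_set)
       (use neg sub in \<open>auto intro: negligible_subset simp: Diff_eq_empty_iff[THEN iffD2]\<close>)
  also have "\<dots> = (LINT v:S|lebesgue. ?H v)"
    using intH set_lebesgue_integral_eq_integral(2)[OF aiH] by simp
  also have "\<dots> = integral\<^sup>L lborel (\<lambda>v. indicator S v *\<^sub>R ?H v)"
    unfolding set_lebesgue_integral_def using Hb by (simp add: integral_completion)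
  also have "\<dots> = (\<integral>x. (\<integral>y. indicator S (vector [x, y] :: real^2) *\<^sub>R ?H (vector [x, y]) \<partial>lborel) \<partial>lborel)"
    by (rule integral_lborel_vec2)
       (use aiH Hb in \<open>simp add: set_integrable_def integrable_completion\<close>)
  also have "\<dots> = (\<integral>x. \<bar>?K\<bar> * (indicator {0<..<1} x * ?h x) \<partial>lborel)"
    by (simp only: inner mult.left_commute)
  also have "\<dots> = \<bar>?K\<bar> * (\<integral>x. indicator {0<..<1} x * ?h x \<partial>lborel)"
    by simp
  also have "(\<integral>x. indicator {0<..<1} x * ?h x \<partial>lborel) = integral {0..1} ?h"
  proof (rule lborel_integral_Ioo_eq_integral_Icc)
    show "continuous_on {0<..<1} ?h"
      by (intro continuous_intros convex_on_continuous) (auto intro: convex_on_subset[OF cG])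
    show "?h absolutely_integrable_on {0..1}"
      by (rule absolutely_integrable_bounded_measurable_product_real)
         (auto intro: convex_on_Icc_integrable[OF cG] continuous_imp_measurable_on_sets_lebesgue
           compact_imp_bounded)
  qed
  finally show ?thesis .
qed


text \<open>The radial formula for the constant function 1; the factor 1/2 is the integral of
  \<open>x\<close> over the unit interval.\<close>

lemma triangle_measure_eq:
  fixes a b c :: "real^2"
  shows "measure lebesgue (convex hull {c, a, b})
    = \<bar>(a - c) $ 1 * (b - c) $ 2 - (b - c) $ 1 * (a - c) $ 2\<bar> / 2"
proof -
  have "convex hull {c, a, b} \<in> lmeasurable"
    by (simp add: compact_convex_hull finite_imp_compact lmeasurable_compact)
  then have "measure lebesgue (convex hull {c, a, b}) = integral (convex hull {c, a, b}) (\<lambda>x. 1)"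
    by (rule lmeasure_integral)
  moreover have "integral {0..1} (\<lambda>x::real. x) = 1/2"
    by (rule integral_unique) (use ident_has_integral[of 0 "1::real"] in simp)
  ultimately show ?thesis
    using integral_triangle_eq_radial[of c a b "\<lambda>x. 1"] 
    by (simp add: avg_seg_def convex_on_const convex_convex_hull)
qed

text \<open>The one-variable bounds applied to the slice averages. Multiplying by the area instead
  of dividing keeps the statement valid for degenerate triangles.\<close>

lemma triangle_integral_bounds:
  fixes f :: "real^2 \<Rightarrow> real"
  assumes f: "convex_on (convex hull {c, a, b}) f"
  defines "S \<equiv> measure lebesgue (convex hull {c, a, b})"
  shows "integral (convex hull {c, a, b}) f \<le> S * (1/3 * f c + 2/3 * avg_seg f a b)"
    and "S * avg_seg f (homothety c (2/3) a) (homothety c (2/3) b) \<le> integral (convex hull {c, a, b}) f"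
proof -
  define G where "G x = avg_seg f (homothety c x a) (homothety c x b)" for x
  have G: "convex_on {0..1} G"
    unfolding G_def by (rule convex_on_avg_seg_homothety[OF f])
  have G01: "G 0 = f c" "G 1 = avg_seg f a b"
    by (simp_all add: G_def homothety_def avg_seg_def)
  have eq: "integral (convex hull {c, a, b}) f = S * (2 * integral {0..1} (\<lambda>x. x * G x))"
    unfolding integral_triangle_eq_radial[OF f] S_def triangle_measure_eq G_def by simp
  have "S \<ge> 0" by (simp add: S_def)
  then show "integral (convex hull {c, a, b}) f \<le> S * (1/3 * f c + 2/3 * avg_seg f a b)"
    unfolding eq using integral_id_mult_convex_bounds(2)[OF G] G01 by (intro mult_left_mono) auto
  show "S * avg_seg f (homothety c (2/3) a) (homothety c (2/3) b) \<le> integral (convex hull {c, a, b}) f"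
    unfolding eq using integral_id_mult_convex_bounds(3)[OF G] \<open>S \<ge> 0\<close>
    by (intro mult_left_mono) (auto simp: G_def)
qed

lemma avg_seg_convex_le:
  fixes f :: "real^2 \<Rightarrow> real"
  assumes f: "convex_on (closed_segment a b) f"
  shows "avg_seg f a b \<le> (f a + f b) / 2"
proof -
  \<comment> \<open>The segment is viewed as a degenerate triangle, whose slice of ratio 1 is the
    segment itself, to obtain integrability.\<close>
  have f': "convex_on (convex hull {a, a, b}) f"
    using f by (simp add: segment_convex_hull)
  have int: "(\<lambda>t. f (linepath a b t)) integrable_on {0..1}"
    using convex_on_Icc_integrable[OF convex_on_homothety_segment[OF f', of 1]]
    by (intro set_lebesgue_integral_eq_integral(1)) (simp add: homothety_def)
  have "avg_seg f a b \<le> integral {0..1} (\<lambda>t. (1 - t) * f a + t * f b)"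
    unfolding avg_seg_def
  proof (rule integral_le[OF int])
    show "(\<lambda>t. (1 - t) * f a + t * f b) integrable_on {0..1}"
      by (intro integrable_continuous_real continuous_intros)
    show "f (linepath a b t) \<le> (1 - t) * f a + t * f b" if "t \<in> {0..1}" for t
      using that unfolding linepath_def by (intro convex_onD[OF f]) auto
  qed
  also have "\<dots> = (f a + f b) / 2"
  proof (rule integral_unique)
    have "((\<lambda>t. (1 - t) * f a + t * f b) has_integral
        ((\<lambda>t. (t - t^2/2) * f a + t^2/2 * f b) 1 - (\<lambda>t. (t - t^2/2) * f a + t^2/2 * f b) 0)) {0..1}"
      by (rule fundamental_theorem_of_calculus)
         (auto intro!: derivative_eq_intros simp flip: has_real_derivative_iff_has_vector_derivative)
    then show "((\<lambda>t. (1 - t) * f a + t * f b) has_integral (f a + f b) / 2) {0..1}"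
      by (simp add: add_divide_distrib)
  qed
  finally show ?thesis .
qed

subsection \<open>Jordan curves and polygons\<close>

text \<open>Linear maps are continuous and so send connected sets to connected sets; one inclusion
  comes from \<open>h\<close>, the other from its linear inverse.\<close>

lemma connected_component_set_linear_bij_image:
  fixes h :: "'a::euclidean_space \<Rightarrow> 'b::euclidean_space"
  assumes h: "linear h" "bij h"
  shows "connected_component_set (h ` U) (h x) = h ` connected_component_set U x"
proof -
  have sub: "g ` connected_component_set V y \<subseteq> connected_component_set (g ` V) (g y)"
    if "linear g" for g :: "'c::euclidean_space \<Rightarrow> 'd::euclidean_space" and V y
  proof clarify
    fix z assume "connected_component V y z"
    then obtain t where "connected t" "t \<subseteq> V" "y \<in> t" "z \<in> t"
      unfolding connected_component_def by blast
    then show "connected_component (g ` V) (g y) (g z)"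
      unfolding connected_component_def using connected_linear_image[OF that, of t]
      by (intro exI[of _ "g ` t"]) auto
  qed
  obtain k where k: "linear k" "k \<circ> h = id"
    using linear_injective_left_inverse h by (metis bij_is_inj)
  have kh: "k (h x) = x" for x
    using k(2) by (rule pointfree_idE)
  have hk: "h (k y) = y" for y
    using bij_is_surj[OF h(2)] kh by (metis surjD)
  have "k ` h ` U = U" by (simp add: image_image kh)
  then have "k ` connected_component_set (h ` U) (h x) \<subseteq> connected_component_set U x"
    using sub[OF k(1), of "h ` U" "h x"] by (simp add: kh)
  then have "h ` k ` connected_component_set (h ` U) (h x) \<subseteq> h ` connected_component_set U x"
    by blast
  then show ?thesis
    using sub[OF h(1), of U x] by (simp add: image_image hk)
qed

lemma inside_outside_linear_bij_image:
  fixes h :: "'a::euclidean_space \<Rightarrow> 'b::euclidean_space"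
  assumes h: "linear h" "bij h"
  shows "inside (h ` S) = h ` inside S" "outside (h ` S) = h ` outside S"
proof -
  have bdd: "bounded (h ` U) \<longleftrightarrow> bounded U" for U
  proof
    assume *: "bounded (h ` U)"
    obtain k where "linear k" "k \<circ> h = id"
      using linear_injective_left_inverse h by (metis bij_is_inj)
    then show "bounded U"
      using bounded_linear_image[OF *, of k] by (simp add: linear_conv_bounded_linear image_comp)
  qed (use h in \<open>simp add: bounded_linear_image linear_conv_bounded_linear\<close>)
  have compl: "- h ` S = h ` (- S)"
    using h(2) by (simp add: bij_image_Compl_eq)
  have cc: "bounded (connected_component_set (- h ` S) (h x)) \<longleftrightarrow> bounded (connected_component_set (- S) x)" for x
    unfolding compl connected_component_set_linear_bij_image[OF h] bdd ..
  have mem: "h x \<in> h ` A \<longleftrightarrow> x \<in> A" for x A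
    using h(2) by (simp add: bij_is_inj inj_image_mem_iff)
  have eqI: "A = h ` B" if "\<And>x. h x \<in> A \<longleftrightarrow> x \<in> B" for A B
  proof
    show "A \<subseteq> h ` B"
    proof
      fix y assume "y \<in> A"
      moreover obtain x where "y = h x" using bij_is_surj[OF h(2)] by (metis surjD)
      ultimately show "y \<in> h ` B" using that by blast
    qed
  qed (use that in blast)
  show "inside (h ` S) = h ` inside S"
    by (rule eqI) (simp add: inside_def cc mem)
  show "outside (h ` S) = h ` outside S"
    by (rule eqI) (simp add: outside cc)
qed

text \<open>The Jordan curve theorem for the complex plane, carried over by the linear bijection
  sending a vector to the complex number with the same coordinates.\<close>

lemma Jordan_curve_plane:
  fixes c :: "real \<Rightarrow> real^2"
  assumes "simple_path c" "pathfinish c = pathstart c"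
  shows "inside (path_image c) \<noteq> {}" "path_image c \<subseteq> closure (outside (path_image c))"
proof -
  define h :: "real^2 \<Rightarrow> complex" where "h v = Complex (v $ 1) (v $ 2)" for v
  have h: "linear h"
    by (rule linearI) (auto simp: h_def complex_eq_iff)
  have "inj h"
    by (auto simp: inj_def h_def vec_eq_iff forall_2)
  moreover have "surj h"
    unfolding surj_def
  proof
    show "\<exists>v. z = h v" for z
      by (rule exI[of _ "vector [Re z, Im z]"]) (simp add: h_def)
  qed
  ultimately have bij: "bij h" by (simp add: bij_def)
  have "simple_path (h \<circ> c)" "pathfinish (h \<circ> c) = pathstart (h \<circ> c)"
    using assms by (simp_all add: simple_path_linear_image_eq[OF h \<open>inj h\<close>] pathfinish_compose pathstart_compose)
  note J = Jordan_inside_outside[OF this, unfolded path_image_compose inside_outside_linear_bij_image[OF h bij]]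
  show "inside (path_image c) \<noteq> {}"
    using J by auto
  have "h ` path_image c \<subseteq> closure (h ` outside (path_image c))"
    using J by (metis closure_Un_frontier sup_ge2)
  then have "h ` path_image c \<subseteq> h ` closure (outside (path_image c))"
    using closure_injective_linear_image[OF h \<open>inj h\<close>] by simp
  then show "path_image c \<subseteq> closure (outside (path_image c))"
    using \<open>inj h\<close> by (simp add: inj_image_subset_iff)
qed

section \<open>Edges of a simple closed polyline\<close>

lemma pathstart_polyline: "vs \<noteq> [] \<Longrightarrow> pathstart (polyline vs) = hd vs"
  by (induction vs rule: polyline.induct) auto

lemma pathfinish_polyline: "vs \<noteq> [] \<Longrightarrow> pathfinish (polyline vs) = last vs"
  by (induction vs rule: polyline.induct) auto

lemma path_image_polyline:
  "2 \<le> length vs \<Longrightarrow>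
    path_image (polyline vs) = (\<Union>i<length vs - 1. closed_segment (vs ! i) (vs ! Suc i))"
proof (induction vs rule: polyline.induct)
  case (4 a b c r)
  have "path_image (polyline (a # b # c # r)) = closed_segment a b \<union> path_image (polyline (b # c # r))"
    by (simp add: path_image_join pathstart_polyline)
  also have "\<dots> = (\<Union>i<Suc (length (b # c # r) - 1). closed_segment ((a # b # c # r) ! i) ((a # b # c # r) ! Suc i))"
    using 4 unfolding lessThan_Suc_eq_insert_0 by (simp add: image_image)
  finally show ?case by simp
qed (auto simp: lessThan_Suc)

text \<open>A common point \<open>p s = q t\<close> is visited by the joined path at the times
  \<open>s / 2\<close> and \<open>(t + 1) / 2\<close>. Loop-freeness makes these times equal or 0
  and 1, which forces \<open>s = 1\<close> or \<open>s = 0\<close>.\<close>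

lemma loop_free_join_overlap:
  fixes p q :: "real \<Rightarrow> 'a::topological_space"
  assumes lf: "loop_free (p +++ q)" and pq: "pathfinish p = pathstart q"
  shows "loop_free q" "path_image p \<inter> path_image q \<subseteq> {pathstart p, pathfinish p}"
proof -
  have P: "(p +++ q) (s / 2) = p s" if "s \<in> {0..1}" for s
    using that by (auto simp: joinpaths_def)
  have Q: "(p +++ q) ((t + 1) / 2) = q t" if "t \<in> {0..1}" for t
    using that pq by (cases "t = 0") (auto simp: joinpaths_def pathfinish_def pathstart_def add_divide_distrib)
  have lf': "x = y \<or> x = 0 \<and> y = 1 \<or> x = 1 \<and> y = 0"
    if "x \<in> {0..1}" "y \<in> {0..1}" "(p +++ q) x = (p +++ q) y" for x y
    using lf that unfolding loop_free_def by blast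
  show "loop_free q"
    unfolding loop_free_def
  proof (intro ballI impI)
    fix x y :: real assume "x \<in> {0..1}" "y \<in> {0..1}" "q x = q y"
    then show "x = y \<or> x = 0 \<and> y = 1 \<or> x = 1 \<and> y = 0"
      using lf'[of "(x + 1) / 2" "(y + 1) / 2"] Q[of x] Q[of y] by auto
  qed
  show "path_image p \<inter> path_image q \<subseteq> {pathstart p, pathfinish p}"
  proof
    fix z assume "z \<in> path_image p \<inter> path_image q"
    then obtain s t where st: "s \<in> {0..1}" "t \<in> {0..1}" "z = p s" "z = q t"
      unfolding path_image_def by blast
    then have "s = 1 \<or> s = 0"
      using lf'[of "s / 2" "(t + 1) / 2"] P[of s] Q[of t] by auto
    then show "z \<in> {pathstart p, pathfinish p}"
      using st by (auto simp: pathstart_def pathfinish_def)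
  qed
qed

text \<open>By induction along the polyline: the first edge meets the rest only in its own
  endpoints. Finiteness, not disjointness, is the right claim because consecutive edges share a
  vertex.\<close>

lemma loop_free_polyline_edges_finite_overlap:
  assumes "loop_free (polyline vs)" "i < j" "Suc j < length vs"
  shows "finite (closed_segment (vs ! i) (vs ! Suc i) \<inter> closed_segment (vs ! j) (vs ! Suc j))"
  using assms
proof (induction vs arbitrary: i j rule: polyline.induct)
  case (4 a b c r)
  have join: "pathfinish (linepath a b) = pathstart (polyline (b # c # r))"
    by (simp add: pathstart_polyline)
  have "loop_free (linepath a b +++ polyline (b # c # r))"
    using "4.prems"(1) by simp
  note lf = loop_free_join_overlap[OF this join]
  obtain j' where j': "j = Suc j'" using "4.prems" by (cases j) auto
  show ?case
  proof (cases i)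
    case 0
    have "closed_segment ((b # c # r) ! j') ((b # c # r) ! Suc j') \<subseteq> path_image (polyline (b # c # r))"
      using "4.prems" j' by (subst path_image_polyline) auto
    then have "closed_segment ((a # b # c # r) ! i) ((a # b # c # r) ! Suc i) \<inter>
        closed_segment ((a # b # c # r) ! j) ((a # b # c # r) ! Suc j) \<subseteq> {a, b}"
      using lf(2) 0 j' by auto
    then show ?thesis by (rule finite_subset) simp
  next
    case (Suc i')
    then show ?thesis
      using "4.IH"[OF lf(1), of i' j'] "4.prems" j' by simp
  qed
qed auto

section \<open>Triangulation of a star-shaped polygon from its center\<close>

lemma in_closed_segment_radial:
  fixes c :: "'a::real_vector"
  shows "x \<in> closed_segment c y \<longleftrightarrow> (\<exists>\<alpha>. 0 \<le> \<alpha> \<and> \<alpha> \<le> 1 \<and> x = c + \<alpha> *\<^sub>R (y - c))"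
proof -
  have "(1 - \<alpha>) *\<^sub>R c + \<alpha> *\<^sub>R y = c + \<alpha> *\<^sub>R (y - c)" for \<alpha>
    by (simp add: algebra_simps)
  then show ?thesis by (simp add: in_segment)
qed

text \<open>On the ray from \<open>c\<close> through \<open>x\<close>, the point \<open>y\<close>
  lies strictly before \<open>z\<close> and not before \<open>x\<close>. A segment from an interior
  point of a convex set to a point of the set is interior except possibly at the far end.\<close>

lemma radial_mem_interior:
  fixes S :: "'a::euclidean_space set"
  assumes S: "convex S" "x \<in> interior S" "z \<in> S"
    and x: "x = c + \<alpha> *\<^sub>R (y - c)" "x = c + \<beta> *\<^sub>R (z - c)"
    and \<alpha>\<beta>: "0 < \<beta>" "\<beta> < \<alpha>" "\<alpha> \<le> 1"
  shows "y \<in> interior S"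
proof -
  \<comment> \<open>Solves \<open>z - e(z - x) = y\<close>, where \<open>y\<close> and
    \<open>z\<close> sit at parameters \<open>1/\<alpha>\<close> and \<open>1/\<beta>\<close> on the
    ray and \<open>x\<close> at parameter 1.\<close>
  define e where "e = (1/\<beta> - 1/\<alpha>) / (1/\<beta> - 1)"
  have \<beta>1: "1/\<beta> > 1" using \<alpha>\<beta> by simp
  have "1/\<alpha> \<ge> 1" "1/\<alpha> < 1/\<beta>" using \<alpha>\<beta> by (auto simp: divide_simps)
  then have e: "0 < e" "e \<le> 1"
    using \<beta>1 by (auto simp: e_def)
  have y: "y = c + (1/\<alpha>) *\<^sub>R (x - c)" using x(1) \<alpha>\<beta> by simp
  have z: "z = c + (1/\<beta>) *\<^sub>R (x - c)" using x(2) \<alpha>\<beta> by simp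
  have "z - x = (1/\<beta> - 1) *\<^sub>R (x - c)"
    by (subst z) (simp add: algebra_simps)
  then have "e *\<^sub>R (z - x) = (1/\<beta> - 1/\<alpha>) *\<^sub>R (x - c)"
    using \<alpha>\<beta> by (simp add: e_def)
  then have "z - e *\<^sub>R (z - x) = y"
    by (subst y, subst (1) z) (simp add: algebra_simps)
  then show ?thesis
    using mem_interior_convex_shrink[OF S e] by simp
qed

lemma nth_polygon_vertices:
  assumes "k < n"
  shows "(map A [0..<n] @ [A 0]) ! k = A k"
    and "(map A [0..<n] @ [A 0]) ! Suc k = A (Suc k mod n)"
proof -
  show "(map A [0..<n] @ [A 0]) ! k = A k"
    using assms by (simp add: nth_append)
  show "(map A [0..<n] @ [A 0]) ! Suc k = A (Suc k mod n)"
  \<comment> \<open>The appended closing vertex \<open>A 0\<close> has index \<open>n\<close>,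
    exactly where \<open>Suc k mod n\<close> wraps around to 0.\<close>
  proof (cases "Suc k = n")
    case True
    then have "(map A [0..<n] @ [A 0]) ! Suc k = A 0"
      by (metis length_map length_upt minus_nat.diff_0 nth_append_length)
    then show ?thesis using True by simp
  qed (use assms in \<open>simp add: nth_append\<close>)
qed

lemma path_image_polygon_boundary:
  assumes "0 < n"
  shows "path_image (polygon_boundary n A) = (\<Union>k<n. closed_segment (A k) (A (Suc k mod n)))"
proof -
  have "path_image (polygon_boundary n A) = (\<Union>k<n. closed_segment
      ((map A [0..<n] @ [A 0]) ! k) ((map A [0..<n] @ [A 0]) ! Suc k))"
    unfolding polygon_boundary_def using assms by (subst path_image_polyline) auto
  also have "\<dots> = (\<Union>k<n. closed_segment (A k) (A (Suc k mod n)))"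
    by (intro SUP_cong refl) (simp only: lessThan_iff nth_polygon_vertices)
  finally show ?thesis .
qed

lemma polygon_edges_finite_overlap:
  assumes "simple_path (polygon_boundary n A)" "k < n" "j < n" "k \<noteq> j"
  shows "finite (closed_segment (A k) (A (Suc k mod n)) \<inter> closed_segment (A j) (A (Suc j mod n)))"
proof -
  let ?vs = "map A [0..<n] @ [A 0]"
  have lf: "loop_free (polyline ?vs)"
    using assms(1) by (simp add: simple_path_def polygon_boundary_def)
  have "finite (closed_segment (A k) (A (Suc k mod n)) \<inter> closed_segment (A j) (A (Suc j mod n)))"
    if "k < j" "j < n" for k j
  proof -
    have "finite (closed_segment (?vs ! k) (?vs ! Suc k) \<inter> closed_segment (?vs ! j) (?vs ! Suc j))"
      using that by (intro loop_free_polyline_edges_finite_overlap[OF lf]) auto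
    then show ?thesis
      by (simp only: nth_polygon_vertices[OF that(2)]
          nth_polygon_vertices[OF order.strict_trans[OF that]])
  qed
  then show ?thesis
    using assms(2-4) by (cases "k < j") (auto simp: Int_commute)
qed

lemma mem_triangle_iff_segment:
  "x \<in> convex hull {c, a, b} \<longleftrightarrow> (\<exists>y\<in>closed_segment a b. x \<in> closed_segment c y)"
  unfolding convex_hull_insert_segments[of c "{a, b}"] segment_convex_hull by simp

lemma polygon_boundary_closed:
  assumes "polygon n A P"
  shows "simple_path (polygon_boundary n A)"
    and "pathfinish (polygon_boundary n A) = pathstart (polygon_boundary n A)"
  using assms by (auto simp: polygon_def polygon_boundary_def pathstart_polyline pathfinish_polyline
      hd_append upt_conv_Cons)

text \<open>The inside of a Jordan curve is open and nonempty. This later rules out that the common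
  area of the triangles is 0.\<close>

lemma polygon_not_negligible:
  assumes "polygon n A P"
  shows "\<not> negligible P"
proof
  assume "negligible P"
  let ?g = "polygon_boundary n A"
  note g = polygon_boundary_closed[OF assms]
  have P: "P = path_image ?g \<union> inside (path_image ?g)"
    using assms by (simp add: polygon_def)
  have "negligible (inside (path_image ?g))"
    using \<open>negligible P\<close> P by (auto intro: negligible_subset)
  moreover have "open (inside (path_image ?g))"
    by (intro open_inside closed_simple_path_image g)
  ultimately show False
    using open_not_negligible Jordan_curve_plane(1)[OF g] by blast
qed

lemma polygon_boundary_disjoint_interior:
  assumes "polygon n A P"
  shows "path_image (polygon_boundary n A) \<inter> interior P = {}"
proof -
  let ?g = "polygon_boundary n A"
  note g = polygon_boundary_closed[OF assms]
  have P: "P = path_image ?g \<union> inside (path_image ?g)"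
    using assms by (simp add: polygon_def)
  have "path_image ?g \<subseteq> closure (- P)"
    using Jordan_curve_plane(2)[OF g] by (simp add: P union_with_inside)
  then show ?thesis
    by (auto simp: closure_complement)
qed

lemma star_polygon_eq_Union_triangles:
  assumes poly: "polygon n A P" and C: "C \<in> kernel P"
  shows "P = (\<Union>k<n. convex hull {C, A k, A (Suc k mod n)})"
proof
  let ?g = "polygon_boundary n A"
  have n: "0 < n" and sp: "simple_path ?g"
    and P: "P = path_image ?g \<union> inside (path_image ?g)"
    using poly by (auto simp: polygon_def)
  note edges = path_image_polygon_boundary[OF n, of A]
  have T: "x \<in> (\<Union>k<n. convex hull {C, A k, A (Suc k mod n)})"
    if "y \<in> path_image ?g" "x \<in> closed_segment C y" for x y
    using that unfolding edges by (auto simp: mem_triangle_iff_segment)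
  show "P \<subseteq> (\<Union>k<n. convex hull {C, A k, A (Suc k mod n)})"
  proof
    fix x assume "x \<in> P"
    then consider "x \<in> path_image ?g" | "x = C" | "x \<in> inside (path_image ?g)" "x \<noteq> C"
      using P by blast
    then show "x \<in> (\<Union>k<n. convex hull {C, A k, A (Suc k mod n)})"
    proof cases
      case 1
      then show ?thesis by (intro T) auto
    next
      case 2
      then show ?thesis using n by (auto intro!: bexI[of _ 0] hull_inc)
    next
      case 3
      let ?I = "inside (path_image ?g)"
      have cl: "closed (path_image ?g)"
        by (intro closed_simple_path_image sp)
      have "bounded ?I"
        by (intro bounded_inside bounded_simple_path_image sp)
      moreover have "x \<in> interior ?I"
        using 3 open_inside[OF cl] by (simp add: interior_open)
      moreover have "x - C \<noteq> 0" using 3 by simp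
      \<comment> \<open>The ray from \<open>x\<close> pointing away from \<open>C\<close> must leave
        the bounded inside; its exit point lies on the boundary and has \<open>x\<close> between
        itself and \<open>C\<close>.\<close>
      ultimately obtain d where d: "0 < d" "x + d *\<^sub>R (x - C) \<in> frontier ?I"
        using ray_to_frontier by blast
      have "x + d *\<^sub>R (x - C) \<in> path_image ?g"
        using d(2) frontier_inside_subset[OF cl] by blast
      moreover have "x \<in> closed_segment C (x + d *\<^sub>R (x - C))"
      proof -
        have "x = C + (1 / (1 + d)) *\<^sub>R ((1 + d) *\<^sub>R (x - C))"
          using d by simp
        also have "(1 + d) *\<^sub>R (x - C) = x + d *\<^sub>R (x - C) - C"
          by (simp add: algebra_simps)
        finally show ?thesis
          unfolding in_closed_segment_radial using d by (intro exI[of _ "1 / (1 + d)"]) auto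
      qed
      ultimately show ?thesis by (rule T)
    qed
  qed
  have "closed_segment C y \<subseteq> P" if "y \<in> path_image ?g" for y
    using C that P unfolding kernel_def by blast
  then show "(\<Union>k<n. convex hull {C, A k, A (Suc k mod n)}) \<subseteq> P"
    unfolding edges by (fastforce simp: mem_triangle_iff_segment)
qed

lemma star_polygon_triangles_negligible_overlap:
  assumes poly: "polygon n A P" and C: "C \<in> kernel P" and kj: "k < n" "j < n" "k \<noteq> j"
  shows "negligible (convex hull {C, A k, A (Suc k mod n)} \<inter> convex hull {C, A j, A (Suc j mod n)})"
proof -
  define E where "E k = closed_segment (A k) (A (Suc k mod n))" for k
  define T where "T k = convex hull {C, A k, A (Suc k mod n)}" for k
  have n: "0 < n" and sp: "simple_path (polygon_boundary n A)"
    using poly by (auto simp: polygon_def)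
  have E: "y \<notin> interior P" if "k < n" "y \<in> E k" for k y
    using polygon_boundary_disjoint_interior[OF poly] that
    unfolding path_image_polygon_boundary[OF n] E_def by blast
  have TP: "interior (T k) \<subseteq> interior P" if "k < n" for k
    using that star_polygon_eq_Union_triangles[OF poly C] by (intro interior_mono) (auto simp: T_def)
  have cvx: "convex (T k)" for k by (simp add: T_def convex_convex_hull)
  have ET: "E k \<subseteq> T k" for k
    by (auto simp: E_def T_def segment_convex_hull intro: hull_mono[THEN subsetD])
  have seg: "\<exists>y\<in>E k. x \<in> closed_segment C y" if "x \<in> T k" for x k
    using that unfolding T_def E_def mem_triangle_iff_segment .
  \<comment> \<open>If a ray from \<open>C\<close> through an interior point of \<open>T j\<close>
    meets edge \<open>k\<close> before edge \<open>j\<close>, the point on edge \<open>k\<close>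
    becomes interior to \<open>T j\<close>, hence to \<open>P\<close>, which is impossible for a
    boundary point.\<close>
  have key: False
    if "k < n" "j < n" "x \<in> interior (T j)" "y \<in> E k" "z \<in> E j"
       "x = C + \<alpha> *\<^sub>R (y - C)" "x = C + \<beta> *\<^sub>R (z - C)" "0 < \<beta>" "\<beta> < \<alpha>" "\<alpha> \<le> 1" for k j x y z \<alpha> \<beta>
    using radial_mem_interior[OF cvx that(3) _ that(6-10)] that ET TP E by blast
  \<comment> \<open>Outside the frontiers and \<open>C\<close>, comparing the radial parameters of
    the two edge points leaves only equality. Then \<open>x\<close> lies on a segment from
    \<open>C\<close> to one of the finitely many points common to both edges.\<close>
  have "T k \<inter> T j \<subseteq> frontier (T k) \<union> frontier (T j) \<union> {C} \<union> (\<Union>p\<in>E k \<inter> E j. closed_segment C p)"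
  proof
    fix x assume x: "x \<in> T k \<inter> T j"
    show "x \<in> frontier (T k) \<union> frontier (T j) \<union> {C} \<union> (\<Union>p\<in>E k \<inter> E j. closed_segment C p)"
    proof (rule ccontr)
      assume neg: "\<not> ?thesis"
      then have int: "x \<in> interior (T k)" "x \<in> interior (T j)" and "x \<noteq> C"
        using x closure_subset by (auto simp: frontier_def)
      obtain y z where y: "y \<in> E k" "x \<in> closed_segment C y" and z: "z \<in> E j" "x \<in> closed_segment C z"
        using seg x by blast
      obtain \<alpha> \<beta> where \<alpha>: "0 \<le> \<alpha>" "\<alpha> \<le> 1" "x = C + \<alpha> *\<^sub>R (y - C)"
        and \<beta>: "0 \<le> \<beta>" "\<beta> \<le> 1" "x = C + \<beta> *\<^sub>R (z - C)"
        using y(2) z(2) unfolding in_closed_segment_radial by metis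
      have pos: "0 < \<alpha>" "0 < \<beta>"
        using \<alpha> \<beta> \<open>x \<noteq> C\<close> by (auto simp: less_le)
      consider "\<beta> < \<alpha>" | "\<alpha> < \<beta>" | "\<alpha> = \<beta>" by linarith
      then show False
      proof cases
        case 1
        then show False using key[of k j x y z] kj int y z \<alpha> \<beta> pos by blast
      next
        case 2
        then show False using key[of j k x z y] kj int y z \<alpha> \<beta> pos by blast
      next
        case 3
        then have "y = z" using \<alpha>(3) \<beta>(3) pos by simp
        then show False using neg y z by blast
      qed
    qed
  qed
  moreover have "negligible (frontier (T k) \<union> frontier (T j) \<union> {C} \<union> (\<Union>p\<in>E k \<inter> E j. closed_segment C p))"
    using polygon_edges_finite_overlap[OF sp kj]
    by (intro negligible_Un negligible_Union negligible_convex_frontier cvx)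
       (auto simp: E_def negligible_closed_segment)
  ultimately show ?thesis
    unfolding T_def by (rule negligible_subset[rotated])
qed


subsection \<open>Averages over a nice polygon\<close>

lemma sum_cyclic_shift:
  fixes g :: "nat \<Rightarrow> 'a::comm_monoid_add"
  assumes "0 < n"
  shows "(\<Sum>k<n. g (Suc k mod n)) = (\<Sum>k<n. g k)"
proof -
  obtain m where n: "n = Suc m" using assms gr0_implies_Suc by blast
  have "(\<Sum>k<n. g (Suc k mod n)) = (\<Sum>k<m. g (Suc k)) + g 0"
    by (simp add: n)
  also have "\<dots> = (\<Sum>k<n. g k)"
    unfolding n sum.lessThan_Suc_shift by (rule add.commute)
  finally show ?thesis .
qed

theorem theorem4p1:
  fixes n :: nat and A :: "nat \<Rightarrow> real^2" and C :: "real^2" and P :: "(real^2) set"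
    and f :: "real^2 \<Rightarrow> real"
  assumes nice: "nice_polygon n A C P"
    and conv: "\<forall>k<n. convex_on (convex hull {C, A k, A (Suc k mod n)}) f"
  shows "avg_area f P \<le> 1/3 * f C
            + 2/3 * (1 / real n * (\<Sum>k<n. avg_seg f (A k) (A (Suc k mod n))))
     \<and> avg_area f P \<le> 1/3 * (1 / real n * (\<Sum>k<n. f (A k)))
            + 2/3 * (1 / real n * (\<Sum>k<n. avg_seg f C (A k)))
     \<and> avg_area f P \<le> 1/3 * f C + 2/3 * (1 / real n * (\<Sum>k<n. f (A k)))
     \<and> (\<forall>A'. (\<forall>k<n. A' k = homothety C (2/3) (A k)) \<longrightarrow>
            1 / real n * (\<Sum>k<n. avg_seg f (A' k) (A' (Suc k mod n))) \<le> avg_area f P)"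
proof -
  define T where "T k = convex hull {C, A k, A (Suc k mod n)}" for k
  define S where "S = measure lebesgue (T 0)"
  define I where "I k = integral (T k) f" for k
  have poly: "polygon n A P" and C: "C \<in> kernel P"
    and area: "measure lebesgue (T k) = S" if "k < n" for k
    using nice that by (auto simp: nice_polygon_def T_def S_def)
  have n: "0 < n"
    using nice by (auto simp: nice_polygon_def polygon_def)
  note poly = poly[OF n] and C = C[OF n]
  have P: "P = (\<Union>k<n. T k)"
    unfolding T_def by (rule star_polygon_eq_Union_triangles[OF poly C])
  have Tm: "T k \<in> lmeasurable" for k
    by (simp add: T_def compact_convex_hull finite_imp_compact lmeasurable_compact)
  have neg: "pairwise (\<lambda>i j. negligible (T i \<inter> T j)) {..<n}"
    unfolding pairwise_def T_def
    using star_polygon_triangles_negligible_overlap[OF poly C] by auto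
  have f: "convex_on (convex hull {C, A k, A (Suc k mod n)}) f" if "k < n" for k
    using conv that by blast
  have "measure lebesgue P = (\<Sum>k<n. measure lebesgue (T k))"
    unfolding P by (rule measure_negligible_finite_Union_image) (use Tm neg in auto)
  then have mP: "measure lebesgue P = n * S"
    using area by simp
  have "P \<in> lmeasurable"
    unfolding P by (intro fmeasurable.finite_UN) (auto intro: Tm)
  then have "measure lebesgue P \<noteq> 0"
    using polygon_not_negligible[OF poly] by (simp add: negligible_iff_measure)
  then have "S \<noteq> 0"
    unfolding mP by auto
  moreover have "0 \<le> S"
    by (simp add: S_def)
  ultimately have S: "0 < S"
    by linarith
  have "(f has_integral (\<Sum>k<n. I k)) P"
    unfolding P I_def
  proof (rule has_integral_UN[OF finite_lessThan _ neg])
    fix k assume "k \<in> {..<n}"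
    then show "(f has_integral integral (T k) f) (T k)"
      unfolding T_def using f[of k]
      by (intro integrable_integral set_lebesgue_integral_eq_integral(1)
          convex_on_triangle_absolutely_integrable) auto
  qed
  then have avg: "avg_area f P = (\<Sum>k<n. I k) / (n * S)"
    by (simp add: avg_area_def mP integral_unique)
  have upper: "avg_area f P \<le> 1 / real n * (\<Sum>k<n. R k)"
    if "\<And>k. k < n \<Longrightarrow> I k \<le> S * R k" for R
  proof -
    have "(\<Sum>k<n. I k) \<le> S * (\<Sum>k<n. R k)"
      unfolding sum_distrib_left by (intro sum_mono that) auto
    then show ?thesis unfolding avg using n S by (simp add: field_simps)
  qed
  have lower: "1 / real n * (\<Sum>k<n. R k) \<le> avg_area f P"
    if "\<And>k. k < n \<Longrightarrow> S * R k \<le> I k" for R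
  proof -
    have "S * (\<Sum>k<n. R k) \<le> (\<Sum>k<n. I k)"
      unfolding sum_distrib_left by (intro sum_mono that) auto
    then show ?thesis unfolding avg using n S by (simp add: field_simps)
  qed
  have I1: "I k \<le> S * (1/3 * f C + 2/3 * avg_seg f (A k) (A (Suc k mod n)))" if "k < n" for k
    using triangle_integral_bounds(1)[OF f[OF that]] area[OF that] by (simp add: I_def T_def)
  have "avg_area f P \<le> 1 / real n * (\<Sum>k<n. 1/3 * f C + 2/3 * avg_seg f (A k) (A (Suc k mod n)))"
    by (rule upper[OF I1])
  also have "\<dots> = 1/3 * f C + 2/3 * (1 / real n * (\<Sum>k<n. avg_seg f (A k) (A (Suc k mod n))))"
    using n unfolding sum.distrib sum_distrib_left[symmetric] by (simp add: field_simps)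
  finally have 1: "avg_area f P \<le> \<dots>" .
  \<comment> \<open>The chord bound is used with apex \<open>A k\<close> and with apex
    \<open>A (Suc k mod n)\<close>, and the two are averaged. The cyclic shift below merges the
    paired terms, turning 1/6 + 1/6 into 1/3 and 1/3 + 1/3 into 2/3.\<close>
  have "avg_area f P \<le> 1 / real n * (\<Sum>k<n. 
      1/6 * f (A k) + 1/6 * f (A (Suc k mod n)) + (1/3 * avg_seg f C (A k) + 1/3 * avg_seg f C (A (Suc k mod n))))"
  proof (rule upper)
    fix k assume k: "k < n"
    let ?a = "A k" and ?b = "A (Suc k mod n)"
    have "I k \<le> S * (1/3 * f ?a + 2/3 * avg_seg f C ?b)"
      using triangle_integral_bounds(1)[of ?a C ?b f] f[OF k] area[OF k]
      by (simp add: I_def T_def insert_commute)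
    moreover have "I k \<le> S * (1/3 * f ?b + 2/3 * avg_seg f C ?a)"
      using triangle_integral_bounds(1)[of ?b C ?a f] f[OF k] area[OF k]
      by (simp add: I_def T_def insert_commute)
    ultimately show "I k \<le> S * (1/6 * f ?a + 1/6 * f ?b + (1/3 * avg_seg f C ?a + 1/3 * avg_seg f C ?b))"
      by (simp add: algebra_simps)
  qed
  also have "\<dots> = 1/3 * (1 / real n * (\<Sum>k<n. f (A k))) + 2/3 * (1 / real n * (\<Sum>k<n. avg_seg f C (A k)))"
    using n sum_cyclic_shift[OF n, of "\<lambda>k. f (A k)"]
      sum_cyclic_shift[OF n, of "\<lambda>k. avg_seg f C (A k)"]
    unfolding sum.distrib sum_distrib_left[symmetric] by (simp add: field_simps)
  finally have 2: "avg_area f P \<le> \<dots>" .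
  \<comment> \<open>The third inequality follows from the first: on an edge, the average of a convex
    function is at most the mean of its endpoint values, and each vertex belongs to two
    edges.\<close>
  have "(\<Sum>k<n. avg_seg f (A k) (A (Suc k mod n))) \<le> (\<Sum>k<n. 1/2 * f (A k) + 1/2 * f (A (Suc k mod n)))"
  proof (rule sum_mono)
    fix k assume "k \<in> {..<n}"
    then have "convex_on (closed_segment (A k) (A (Suc k mod n))) f"
      unfolding segment_convex_hull
      by (intro convex_on_subset[OF f[of k]] hull_mono convex_convex_hull) auto
    then show "avg_seg f (A k) (A (Suc k mod n)) \<le> 1/2 * f (A k) + 1/2 * f (A (Suc k mod n))"
      using avg_seg_convex_le by fastforce
  qed
  also have "\<dots> = (\<Sum>k<n. f (A k))"
    using sum_cyclic_shift[OF n, of "\<lambda>k. f (A k)"]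
    unfolding sum.distrib sum_distrib_left[symmetric] by simp
  finally have "1 / real n * (\<Sum>k<n. avg_seg f (A k) (A (Suc k mod n))) \<le> 1 / real n * (\<Sum>k<n. f (A k))"
    by (rule mult_left_mono) simp
  with 1 have 3: "avg_area f P \<le> 1/3 * f C + 2/3 * (1 / real n * (\<Sum>k<n. f (A k)))"
    by linarith
  have 4: "1 / real n * (\<Sum>k<n. avg_seg f (A' k) (A' (Suc k mod n))) \<le> avg_area f P"
    if A': "\<forall>k<n. A' k = homothety C (2/3) (A k)" for A'
  proof (rule lower)
    fix k assume k: "k < n"
    \<comment> \<open>\<open>A'\<close> is prescribed only at indices below \<open>n\<close>, so the
      successor index must be seen to stay in that range.\<close>
    then have "Suc k mod n < n" by simp
    then show "S * avg_seg f (A' k) (A' (Suc k mod n)) \<le> I k"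
      using triangle_integral_bounds(2)[OF f[OF k]] area[OF k] A' k by (simp add: I_def T_def)
  qed
  show ?thesis using 1 2 3 4 by blast
qed

end
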